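(* Let $S$ be a Hausdorff topological semigroup which contains $\mathscr{I}_{\infty}^{\nearrow}(\mathbb{N})$ as a proper, dense subsemigroup that is locally compact in the subspace topology. Then $\mathscr{I}_{\infty}^{\nearrow}(\mathbb{N})$ is an open subsemigroup of $S$ and $S\setminus\mathscr{I}_{\infty}^{\nearrow}(\mathbb{N})$ is a (two-sided) ideal of $S$.
   Context: $\mathbb{N}$ is the set of positive integers. $\mathscr{I}_{\infty}^{\nearrow}(\mathbb{N})$ is the set of all injective, order-preserving (hence strictly increasing) partial maps $\varphi\colon\mathbb{N}\rightharpoonup\mathbb{N}$ such that $\mathbb{N}\setminus\operatorname{dom}\varphi$ and $\mathbb{N}\setminus\operatorname{ran}\varphi$ are finite, where $\operatorname{ran}\varphi$ is the image of $\varphi$. The operation is composition of partial maps written on the right: $x(\alpha\beta)=(x\alpha)\beta$, with $\operatorname{dom}(\alpha\beta)=\{y\in\operatorname{dom}\alpha\mid y\alpha\in\operatorname{dom}\beta\}$. A topological semigroup is a semigroup with a topology for which the multiplication $S\times S\to S$ is (jointly) continuous. *)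

theory Defs
  imports "HOL-Analysis.Analysis"
begin

text \<open>
  Partial maps of the positive integers are represented as \<^typ>\<open>nat \<rightharpoonup> nat\<close> with domain and
  range contained in \<open>{1..}\<close>.
\<close>

definition cofinite_monotone_injections :: "(nat \<rightharpoonup> nat) set" where
  "cofinite_monotone_injections =
     {\<phi>. dom \<phi> \<subseteq> {1..} \<and> ran \<phi> \<subseteq> {1..} \<and>
         inj_on \<phi> (dom \<phi>) \<and> mono_on (dom \<phi>) (\<lambda>x. the (\<phi> x)) \<and>
         finite ({1..} - dom \<phi>) \<and> finite ({1..} - ran \<phi>)}"

text \<open>
  Maps act on the right, so the product \<open>\<alpha>\<beta>\<close> applies \<open>\<alpha>\<close> first.
\<close>

definition pcomp :: "(nat \<rightharpoonup> nat) \<Rightarrow> (nat \<rightharpoonup> nat) \<Rightarrow> (nat \<rightharpoonup> nat)" (infixl "\<Zsemi>" 70) where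
  "\<alpha> \<Zsemi> \<beta> = \<beta> \<circ>\<^sub>m \<alpha>"

lemma dom_pcomp: "dom (\<alpha> \<Zsemi> \<beta>) = {y \<in> dom \<alpha>. the (\<alpha> y) \<in> dom \<beta>}"
  by (auto simp: pcomp_def map_comp_def dom_def split: option.splits)

definition subsemigroup :: "'a::semigroup_mult set \<Rightarrow> bool" where
  "subsemigroup T \<longleftrightarrow> T \<noteq> {} \<and> (\<forall>x\<in>T. \<forall>y\<in>T. x * y \<in> T)"

definition two_sided_ideal :: "'a::semigroup_mult set \<Rightarrow> bool" where
  "two_sided_ideal J \<longleftrightarrow> J \<noteq> {} \<and> (\<forall>x\<in>J. \<forall>s. s * x \<in> J \<and> x * s \<in> J)"

text \<open>
  A semigroup \<open>S\<close>, given as a type, contains the semigroup of cofinite monotone injections as a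
  subsemigroup by way of an injective homomorphism; the subsemigroup itself is the image of
  \<^const>\<open>cofinite_monotone_injections\<close> under it.
\<close>

definition semigroup_embedding :: "((nat \<rightharpoonup> nat) \<Rightarrow> 'a::semigroup_mult) \<Rightarrow> bool" where
  "semigroup_embedding h \<longleftrightarrow>
     inj_on h cofinite_monotone_injections \<and>
     (\<forall>\<alpha>\<in>cofinite_monotone_injections. \<forall>\<beta>\<in>cofinite_monotone_injections.
        h (\<alpha> \<Zsemi> \<beta>) = h \<alpha> * h \<beta>)"

lemma pcomp_closed:
  assumes "\<alpha> \<in> cofinite_monotone_injections" "\<beta> \<in> cofinite_monotone_injections"
  shows "\<alpha> \<Zsemi> \<beta> \<in> cofinite_monotone_injections"
proof -
  have A: "dom \<alpha> \<subseteq> {1..}" "ran \<alpha> \<subseteq> {1..}" "inj_on \<alpha> (dom \<alpha>)" "mono_on (dom \<alpha>) (\<lambda>x. the (\<alpha> x))"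
      "finite ({1..} - dom \<alpha>)" "finite ({1..} - ran \<alpha>)"
    and B: "dom \<beta> \<subseteq> {1..}" "ran \<beta> \<subseteq> {1..}" "inj_on \<beta> (dom \<beta>)" "mono_on (dom \<beta>) (\<lambda>x. the (\<beta> x))"
      "finite ({1..} - dom \<beta>)" "finite ({1..} - ran \<beta>)"
    using assms by (auto simp: cofinite_monotone_injections_def)
  have ran_comp: "z \<in> ran (\<alpha> \<Zsemi> \<beta>) \<longleftrightarrow> (\<exists>x y. \<alpha> x = Some y \<and> \<beta> y = Some z)" for z
    by (auto simp: pcomp_def map_comp_def ran_def split: option.splits)
  have 1: "dom (\<alpha> \<Zsemi> \<beta>) \<subseteq> {1..}"
    using A(1) by (auto simp: dom_pcomp)
  have 2: "ran (\<alpha> \<Zsemi> \<beta>) \<subseteq> {1..}"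
  proof
    fix z assume "z \<in> ran (\<alpha> \<Zsemi> \<beta>)"
    then obtain y where "\<beta> y = Some z" using ran_comp by blast
    then show "z \<in> {1..}" using B(2) ranI by fastforce
  qed
  have 3: "inj_on (\<alpha> \<Zsemi> \<beta>) (dom (\<alpha> \<Zsemi> \<beta>))"
  proof (rule inj_onI)
    fix x y assume xy: "x \<in> dom (\<alpha> \<Zsemi> \<beta>)" "y \<in> dom (\<alpha> \<Zsemi> \<beta>)" "(\<alpha> \<Zsemi> \<beta>) x = (\<alpha> \<Zsemi> \<beta>) y"
    obtain u where u: "\<alpha> x = Some u" "u \<in> dom \<beta>"
      using xy(1) unfolding dom_pcomp by fastforce
    obtain v where v: "\<alpha> y = Some v" "v \<in> dom \<beta>"
      using xy(2) unfolding dom_pcomp by fastforce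
    note uv = u(1) v(1) u(2) v(2)
    with xy(3) have "\<beta> u = \<beta> v" by (simp add: pcomp_def)
    then have "u = v" using inj_onD[OF B(3)] uv(3,4) by blast
    then have "\<alpha> x = \<alpha> y" "x \<in> dom \<alpha>" "y \<in> dom \<alpha>" using uv(1,2) by auto
    then show "x = y" using inj_onD[OF A(3)] by blast
  qed
  have 4: "mono_on (dom (\<alpha> \<Zsemi> \<beta>)) (\<lambda>x. the ((\<alpha> \<Zsemi> \<beta>) x))"
  proof (rule mono_onI)
    fix x y assume xy: "x \<in> dom (\<alpha> \<Zsemi> \<beta>)" "y \<in> dom (\<alpha> \<Zsemi> \<beta>)" "x \<le> y"
    obtain u where u: "\<alpha> x = Some u" "u \<in> dom \<beta>"
      using xy(1) unfolding dom_pcomp by fastforce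
    obtain v where v: "\<alpha> y = Some v" "v \<in> dom \<beta>"
      using xy(2) unfolding dom_pcomp by fastforce
    note uv = u(1) v(1) u(2) v(2)
    have "u \<le> v" using mono_onD[OF A(4), of x y] uv xy(3) by (auto simp: domI)
    then show "the ((\<alpha> \<Zsemi> \<beta>) x) \<le> the ((\<alpha> \<Zsemi> \<beta>) y)"
      using mono_onD[OF B(4), of u v] uv by (simp add: pcomp_def)
  qed
  have inj: "inj_on (\<lambda>x. the (\<alpha> x)) (dom \<alpha>)"
    using A(3) unfolding inj_on_def by (metis domIff option.expand)
  have "finite ((\<lambda>x. the (\<alpha> x)) -` ({1..} - dom \<beta>) \<inter> dom \<alpha>)"
    by (rule finite_vimage_IntI[OF B(5) inj])
  moreover have "{1..} - dom (\<alpha> \<Zsemi> \<beta>) \<subseteq>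
      ({1..} - dom \<alpha>) \<union> ((\<lambda>x. the (\<alpha> x)) -` ({1..} - dom \<beta>) \<inter> dom \<alpha>)"
  proof
    fix x assume x: "x \<in> {1..} - dom (\<alpha> \<Zsemi> \<beta>)"
    show "x \<in> ({1..} - dom \<alpha>) \<union> ((\<lambda>x. the (\<alpha> x)) -` ({1..} - dom \<beta>) \<inter> dom \<alpha>)"
    proof (cases "\<alpha> x")
      case None
      then show ?thesis using x by (simp add: domIff)
    next
      case (Some u)
      then have "u \<in> {1..}" using A(2) ranI by fast
      moreover have "x \<in> dom \<alpha>" using Some by (rule domI)
      moreover have "u \<notin> dom \<beta>" using x Some \<open>x \<in> dom \<alpha>\<close> unfolding dom_pcomp by simp
      ultimately show ?thesis using Some by simp
    qed
  qed
  ultimately have 5: "finite ({1..} - dom (\<alpha> \<Zsemi> \<beta>))"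
    using A(5) by (meson finite_UnI finite_subset)
  have "z \<in> ({1..} - ran \<beta>) \<union> (\<lambda>y. the (\<beta> y)) ` ({1..} - ran \<alpha>)"
    if z: "z \<in> {1..} - ran (\<alpha> \<Zsemi> \<beta>)" for z
  proof (cases "z \<in> ran \<beta>")
    case True
    then obtain y where y: "\<beta> y = Some z" unfolding ran_def by blast
    have "y \<notin> ran \<alpha>"
    proof
      assume "y \<in> ran \<alpha>"
      then obtain x where "\<alpha> x = Some y" unfolding ran_def by blast
      with y have "z \<in> ran (\<alpha> \<Zsemi> \<beta>)" using ran_comp by blast
      with z show False by simp
    qed
    moreover have "y \<in> {1..}" using y B(1) by (blast intro: domI)
    ultimately show ?thesis using y by (intro UnI2 image_eqI[where x = y]) simp_all
  next
    case False
    then show ?thesis using z by simp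
  qed
  then have 6: "finite ({1..} - ran (\<alpha> \<Zsemi> \<beta>))"
    using A(6) B(6) by (meson finite_UnI finite_imageI finite_subset subsetI)
  show ?thesis
    using 1 2 3 4 5 6 by (simp add: cofinite_monotone_injections_def)
qed

end

theory Submission
  imports Defs
begin

text \<open>
  The algebraic core is that equations \<open>\<alpha> \<xi> = \<gamma>\<close> and \<open>\<xi> \<alpha> = \<gamma>\<close> between cofinite monotone
  injections have only finitely many solutions \<open>\<xi>\<close>: cancelling \<open>\<alpha>\<close> with its inverse partial map
  prescribes \<open>\<xi>\<close> on a cofinite set, and such a prescription has finitely many extensions
  (\<open>finite_extensions\<close>). The other algebraic facts are that the semigroup \<open>I\<close> is countable and
  that it is simple: every \<open>\<gamma>\<close> is of the form \<open>\<beta> \<alpha> \<delta>\<close> for any given \<open>\<alpha>\<close>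
  (\<open>exists_factorization_through\<close>).

  A countable locally compact Hausdorff space has an isolated point by the Baire category theorem,
  so some \<open>\<gamma>\<close> is isolated in \<open>I\<close>. For any \<open>\<alpha>\<close> with \<open>\<beta> \<alpha> \<delta> = \<gamma>\<close>, take
  a neighbourhood of \<open>\<gamma>\<close> in \<open>S\<close> that contains no other point of \<open>I\<close>. Its preimage under \<open>x \<mapsto> \<beta> x \<delta>\<close> is an open neighbourhood of \<open>\<alpha>\<close> in \<open>S\<close> with finitely
  many points in \<open>I\<close>. An open set with finite trace on a dense set is contained in that trace
  (\<open>open_subset_dense_if_finite_Int\<close>), so \<open>\<alpha>\<close> is isolated even in \<open>S\<close>, and \<open>I\<close> is open.

  For the ideal property, suppose \<open>s x = c\<close> with \<open>c \<in> I\<close>. Since \<open>c\<close> is isolated, joint continuity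
  gives \<open>a v = c\<close> for some fixed \<open>a \<in> I\<close> near \<open>s\<close> and every \<open>v \<in> I\<close> near \<open>x\<close>. By finiteness of
  solutions, \<open>x\<close> has a neighbourhood with finite trace on \<open>I\<close>, hence \<open>x \<in> I\<close>
  (\<open>right_factor_in_dense\<close>); the case \<open>x s = c\<close> is symmetric.
\<close>

section \<open>The inverse semigroup of cofinite monotone injections\<close>

lemma pcomp_eq_Some_iff: "(\<alpha> \<Zsemi> \<beta>) x = Some z \<longleftrightarrow> (\<exists>y. \<alpha> x = Some y \<and> \<beta> y = Some z)"
  by (simp add: pcomp_def map_comp_Some_iff)

lemma map_le_iff_Some: "\<alpha> \<subseteq>\<^sub>m \<beta> \<longleftrightarrow> (\<forall>x y. \<alpha> x = Some y \<longrightarrow> \<beta> x = Some y)"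
  by (force simp: map_le_def dom_def)

lemma map_eq_iff_Some: "\<alpha> = \<beta> \<longleftrightarrow> (\<forall>x y. \<alpha> x = Some y \<longleftrightarrow> \<beta> x = Some y)"
  by (metis ext not_Some_eq)

lemma pcomp_assoc: "\<alpha> \<Zsemi> \<beta> \<Zsemi> \<gamma> = \<alpha> \<Zsemi> (\<beta> \<Zsemi> \<gamma>)"
  by (auto simp: map_eq_iff_Some pcomp_eq_Some_iff)

lemma cofinite_monotone_injections_iff:
  "\<alpha> \<in> cofinite_monotone_injections \<longleftrightarrow>
     (\<forall>x y. \<alpha> x = Some y \<longrightarrow> 1 \<le> x \<and> 1 \<le> y) \<and>
     (\<forall>x y x' y'. \<alpha> x = Some y \<longrightarrow> \<alpha> x' = Some y' \<longrightarrow> (x < x' \<longleftrightarrow> y < y')) \<and>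
     finite ({1..} - dom \<alpha>) \<and> finite ({1..} - ran \<alpha>)"
  (is "_ \<longleftrightarrow> ?pos \<and> ?mono \<and> ?cofin")
proof
  assume \<alpha>: "\<alpha> \<in> cofinite_monotone_injections"
  have ?pos
    using \<alpha> by (auto simp: cofinite_monotone_injections_def dom_def ran_def)
  moreover have ?mono
  proof (intro allI impI)
    fix x y x' y' assume xy: "\<alpha> x = Some y" "\<alpha> x' = Some y'"
    have le: "u \<le> u' \<Longrightarrow> v \<le> v'" if "\<alpha> u = Some v" "\<alpha> u' = Some v'" for u u' v v'
      using \<alpha> that mono_onD[of "dom \<alpha>" "\<lambda>x. the (\<alpha> x)" u u']
      by (auto simp: cofinite_monotone_injections_def)
    have "inj_on \<alpha> (dom \<alpha>)"
      using \<alpha> by (simp add: cofinite_monotone_injections_def)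
    then have "y = y' \<Longrightarrow> x = x'"
      using xy by (metis domI inj_onD)
    then show "x < x' \<longleftrightarrow> y < y'"
      using le[OF xy] le[OF xy(2) xy(1)] xy by (metis leD le_less linorder_not_less)
  qed
  ultimately show "?pos \<and> ?mono \<and> ?cofin"
    using \<alpha> by (simp add: cofinite_monotone_injections_def)
next
  assume \<alpha>: "?pos \<and> ?mono \<and> ?cofin"
  then have mono: "x < x' \<longleftrightarrow> y < y'" if "\<alpha> x = Some y" "\<alpha> x' = Some y'" for x x' y y'
    using that by blast
  have "dom \<alpha> \<subseteq> {1..}" "ran \<alpha> \<subseteq> {1..}"
    using \<alpha> by (auto simp: dom_def ran_def)
  moreover have "inj_on \<alpha> (dom \<alpha>)"
    using mono by (intro inj_onI) (metis domD less_irrefl linorder_neqE_nat)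
  moreover have "mono_on (dom \<alpha>) (\<lambda>x. the (\<alpha> x))"
    using mono by (intro mono_onI) (metis domD linorder_not_less option.sel)
  ultimately show "\<alpha> \<in> cofinite_monotone_injections"
    using \<alpha> by (simp add: cofinite_monotone_injections_def)
qed

lemma cofinite_monotone_injections_less_iff:
  assumes "\<alpha> \<in> cofinite_monotone_injections" "\<alpha> x = Some y" "\<alpha> x' = Some y'"
  shows "x < x' \<longleftrightarrow> y < y'"
  using assms cofinite_monotone_injections_iff by blast

lemma cofinite_monotone_injections_inject:
  assumes "\<alpha> \<in> cofinite_monotone_injections" "\<alpha> x = Some y" "\<alpha> x' = Some y"
  shows "x = x'"
  using cofinite_monotone_injections_less_iff[OF assms]
    cofinite_monotone_injections_less_iff[OF assms(1,3,2)] by simp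

definition pinverse :: "('a \<rightharpoonup> 'b) \<Rightarrow> ('b \<rightharpoonup> 'a)" where
  "pinverse \<alpha> y = (if y \<in> ran \<alpha> then Some (SOME x. \<alpha> x = Some y) else None)"

lemma pinverse_eq_Some_iff:
  assumes "\<alpha> \<in> cofinite_monotone_injections"
  shows "pinverse \<alpha> y = Some x \<longleftrightarrow> \<alpha> x = Some y"
proof
  assume "pinverse \<alpha> y = Some x"
  then have "y \<in> ran \<alpha>" "x = (SOME x. \<alpha> x = Some y)"
    by (auto simp: pinverse_def split: if_splits)
  then show "\<alpha> x = Some y"
    by (metis (mono_tags, lifting) ran_def mem_Collect_eq someI_ex)
next
  assume x: "\<alpha> x = Some y"
  then have "(SOME x. \<alpha> x = Some y) = x"
    using cofinite_monotone_injections_inject[OF assms] by (intro some_equality) auto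
  then show "pinverse \<alpha> y = Some x"
    using x by (simp add: pinverse_def ranI)
qed

lemma pinverse_closed:
  assumes "\<alpha> \<in> cofinite_monotone_injections"
  shows "pinverse \<alpha> \<in> cofinite_monotone_injections"
proof -
  have "dom (pinverse \<alpha>) = ran \<alpha>" "ran (pinverse \<alpha>) = dom \<alpha>"
    using pinverse_eq_Some_iff[OF assms] by (auto simp: dom_def ran_def)
  then show ?thesis
    using assms by (auto simp: cofinite_monotone_injections_iff pinverse_eq_Some_iff[OF assms])
qed

text \<open>
  An extension of \<open>\<alpha>\<close> can take new values only on the finite complement of the domain of \<open>\<alpha>\<close>, and
  injectivity forces these values into the finite complement of its range.
\<close>

lemma finite_extensions:
  assumes \<alpha>: "\<alpha> \<in> cofinite_monotone_injections"
  shows "finite {\<xi> \<in> cofinite_monotone_injections. \<alpha> \<subseteq>\<^sub>m \<xi>}" (is "finite ?X")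
proof -
  let ?F = "{1..} - dom \<alpha>" and ?G = "{1..} - ran \<alpha>"
  let ?new = "\<lambda>\<xi>. {(x, y). \<xi> x = Some y \<and> x \<notin> dom \<alpha>}"
  have "?new \<xi> \<subseteq> ?F \<times> ?G" if \<xi>: "\<xi> \<in> ?X" for \<xi>
  proof (rule subrelI)
    fix x y assume "(x, y) \<in> ?new \<xi>"
    then have xy: "\<xi> x = Some y" "x \<notin> dom \<alpha>" by simp_all
    have "y \<notin> ran \<alpha>"
    proof
      assume "y \<in> ran \<alpha>"
      then obtain x' where x': "\<alpha> x' = Some y" by (auto simp: ran_def)
      with \<xi> have "\<xi> x' = Some y" by (simp add: map_le_iff_Some)
      with \<xi> xy(1) have "x' = x" using cofinite_monotone_injections_inject by blast
      with x' xy(2) show False by auto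
    qed
    moreover have "1 \<le> x" "1 \<le> y"
      using \<xi> xy(1) cofinite_monotone_injections_iff by blast+
    ultimately show "(x, y) \<in> ?F \<times> ?G" using xy(2) by simp
  qed
  then have "?new ` ?X \<subseteq> Pow (?F \<times> ?G)" by blast
  moreover have "finite (?F \<times> ?G)"
    using \<alpha> by (simp add: cofinite_monotone_injections_iff)
  ultimately have "finite (?new ` ?X)"
    by (meson finite_Pow_iff finite_subset)
  moreover have "inj_on ?new ?X"
  proof (rule inj_onI)
    fix \<xi> \<zeta> assume X: "\<xi> \<in> ?X" "\<zeta> \<in> ?X" and eq: "?new \<xi> = ?new \<zeta>"
    have "\<xi> x = \<zeta> x" for x
    proof (cases "x \<in> dom \<alpha>")
      case True
      then show ?thesis using X by (simp add: map_le_def)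
    next
      case False
      then have "\<xi> x = Some y \<longleftrightarrow> \<zeta> x = Some y" for y using eq by blast
      then show ?thesis by (metis not_Some_eq)
    qed
    then show "\<xi> = \<zeta>" by blast
  qed
  ultimately show ?thesis by (rule finite_imageD)
qed

text \<open>
  Every solution extends \<open>\<alpha>\<inverse> \<gamma> = \<alpha>\<inverse> \<alpha> \<xi>\<close>, because \<open>\<alpha>\<inverse> \<alpha>\<close> is a partial identity.
\<close>

lemma finite_solutions_mult_left:
  assumes \<alpha>: "\<alpha> \<in> cofinite_monotone_injections" and \<gamma>: "\<gamma> \<in> cofinite_monotone_injections"
  shows "finite {\<xi> \<in> cofinite_monotone_injections. \<alpha> \<Zsemi> \<xi> = \<gamma>}"
proof (rule finite_subset[OF _ finite_extensions])
  show "pinverse \<alpha> \<Zsemi> \<gamma> \<in> cofinite_monotone_injections"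
    using assms by (simp add: pcomp_closed pinverse_closed)
  show "{\<xi> \<in> cofinite_monotone_injections. \<alpha> \<Zsemi> \<xi> = \<gamma>} \<subseteq>
      {\<xi> \<in> cofinite_monotone_injections. pinverse \<alpha> \<Zsemi> \<gamma> \<subseteq>\<^sub>m \<xi>}"
    by (auto simp: map_le_iff_Some pcomp_eq_Some_iff pinverse_eq_Some_iff[OF \<alpha>])
qed

lemma finite_solutions_mult_right:
  assumes \<alpha>: "\<alpha> \<in> cofinite_monotone_injections" and \<gamma>: "\<gamma> \<in> cofinite_monotone_injections"
  shows "finite {\<xi> \<in> cofinite_monotone_injections. \<xi> \<Zsemi> \<alpha> = \<gamma>}"
proof (rule finite_subset[OF _ finite_extensions])
  show "\<gamma> \<Zsemi> pinverse \<alpha> \<in> cofinite_monotone_injections"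
    using assms by (simp add: pcomp_closed pinverse_closed)
  show "{\<xi> \<in> cofinite_monotone_injections. \<xi> \<Zsemi> \<alpha> = \<gamma>} \<subseteq>
      {\<xi> \<in> cofinite_monotone_injections. \<gamma> \<Zsemi> pinverse \<alpha> \<subseteq>\<^sub>m \<xi>}"
    using cofinite_monotone_injections_inject[OF \<alpha>]
    by (fastforce simp: map_le_iff_Some pcomp_eq_Some_iff pinverse_eq_Some_iff[OF \<alpha>])
qed

text \<open>
  If \<open>\<beta> \<xi> \<delta> = \<gamma>\<close>, then \<open>\<xi> \<delta>\<close> is one of the finitely many solutions \<open>\<eta>\<close> of \<open>\<beta> \<eta> = \<gamma>\<close>, and each
  of these leaves finitely many \<open>\<xi>\<close>.
\<close>

lemma finite_solutions_mult_both:
  assumes "\<beta> \<in> cofinite_monotone_injections" "\<delta> \<in> cofinite_monotone_injections"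
    and "\<gamma> \<in> cofinite_monotone_injections"
  shows "finite {\<xi> \<in> cofinite_monotone_injections. \<beta> \<Zsemi> \<xi> \<Zsemi> \<delta> = \<gamma>}"
proof (rule finite_subset)
  let ?Y = "{\<eta> \<in> cofinite_monotone_injections. \<beta> \<Zsemi> \<eta> = \<gamma>}"
  show "{\<xi> \<in> cofinite_monotone_injections. \<beta> \<Zsemi> \<xi> \<Zsemi> \<delta> = \<gamma>} \<subseteq>
      (\<Union>\<eta>\<in>?Y. {\<xi> \<in> cofinite_monotone_injections. \<xi> \<Zsemi> \<delta> = \<eta>})"
    using assms by (auto simp: pcomp_assoc pcomp_closed)
  show "finite (\<Union>\<eta>\<in>?Y. {\<xi> \<in> cofinite_monotone_injections. \<xi> \<Zsemi> \<delta> = \<eta>})"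
    using assms by (auto intro!: finite_solutions_mult_left finite_solutions_mult_right)
qed

lemma exists_total_with_range:
  assumes A: "A \<subseteq> {1..}" "finite ({1..} - A)"
  obtains \<epsilon> where "\<epsilon> \<in> cofinite_monotone_injections" "dom \<epsilon> = {1..}" "ran \<epsilon> = A"
proof -
  have inf: "infinite A"
    using A infinite_Ici by (metis Diff_infinite_finite Diff_Diff_Int finite_Int)
  \<comment> \<open>\<^const>\<open>enumerate\<close> counts from \<open>0\<close>, the positive integers from \<open>1\<close>.\<close>
  define \<epsilon> where "\<epsilon> x = (if 1 \<le> x then Some (enumerate A (x - 1)) else None)" for x
  have Some: "\<epsilon> x = Some y \<longleftrightarrow> 1 \<le> x \<and> y = enumerate A (x - 1)" for x y
    by (auto simp: \<epsilon>_def)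
  have dom: "dom \<epsilon> = {1..}"
    by (auto simp: dom_def Some)
  have "ran \<epsilon> = range (enumerate A)"
    by (auto simp: ran_def Some intro!: exI[of _ "Suc _"])
  then have ran: "ran \<epsilon> = A"
    using range_enumerate[OF inf] by simp
  have "\<epsilon> \<in> cofinite_monotone_injections"
    unfolding cofinite_monotone_injections_iff dom ran
    using A enumerate_in_set[OF inf] inf by (auto simp: Some)
  then show thesis using dom ran that by blast
qed

text \<open>
  This says that the semigroup is simple. A monotone bijection \<open>\<beta>\<close> from the domain of \<open>\<gamma>\<close> onto
  the domain of \<open>\<alpha>\<close> exists, because both are order-isomorphic to the positive integers, and with
  \<open>\<delta> = \<alpha>\<inverse> \<beta>\<inverse> \<gamma>\<close> all factors of \<open>\<beta> \<alpha> \<alpha>\<inverse> \<beta>\<inverse> \<gamma>\<close> before \<open>\<gamma>\<close> cancel to the identity on the domain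
  of \<open>\<gamma>\<close>.
\<close>

lemma exists_factorization_through:
  assumes \<alpha>: "\<alpha> \<in> cofinite_monotone_injections" and \<gamma>: "\<gamma> \<in> cofinite_monotone_injections"
  obtains \<beta> \<delta> where "\<beta> \<in> cofinite_monotone_injections" "\<delta> \<in> cofinite_monotone_injections"
    "\<beta> \<Zsemi> \<alpha> \<Zsemi> \<delta> = \<gamma>"
proof -
  have dom: "dom \<xi> \<subseteq> {1..}" "finite ({1..} - dom \<xi>)"
    if "\<xi> \<in> cofinite_monotone_injections" for \<xi>
    using that by (auto simp: cofinite_monotone_injections_def)
  obtain \<epsilon> where \<epsilon>: "\<epsilon> \<in> cofinite_monotone_injections" "dom \<epsilon> = {1..}" "ran \<epsilon> = dom \<alpha>"
    using exists_total_with_range[OF dom[OF \<alpha>]] .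
  obtain \<zeta> where \<zeta>: "\<zeta> \<in> cofinite_monotone_injections" "dom \<zeta> = {1..}" "ran \<zeta> = dom \<gamma>"
    using exists_total_with_range[OF dom[OF \<gamma>]] .
  define \<beta> where "\<beta> = pinverse \<zeta> \<Zsemi> \<epsilon>"
  have \<beta>: "\<beta> \<in> cofinite_monotone_injections"
    using \<epsilon> \<zeta> by (simp add: \<beta>_def pcomp_closed pinverse_closed)
  have dom_le: "\<exists>y z. \<beta> x = Some y \<and> \<alpha> y = Some z" if "\<gamma> x = Some w" for x w
  proof -
    have "x \<in> ran \<zeta>" using that \<zeta>(3) by blast
    then obtain k where k: "\<zeta> k = Some x" by (auto simp: ran_def)
    then have "k \<in> dom \<epsilon>" using \<zeta>(2) \<epsilon>(2) by blast
    then obtain y where y: "\<epsilon> k = Some y" by blast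
    then have "y \<in> dom \<alpha>" using \<epsilon>(3) by (auto simp: ran_def)
    then show ?thesis
      using k y by (auto simp: \<beta>_def pcomp_eq_Some_iff pinverse_eq_Some_iff[OF \<zeta>(1)])
  qed
  let ?\<delta> = "pinverse \<alpha> \<Zsemi> pinverse \<beta> \<Zsemi> \<gamma>"
  have "(\<beta> \<Zsemi> \<alpha> \<Zsemi> ?\<delta>) x = Some w \<longleftrightarrow> \<gamma> x = Some w" for x w
  proof
    assume "(\<beta> \<Zsemi> \<alpha> \<Zsemi> ?\<delta>) x = Some w"
    then obtain y z y' x' where *: "\<beta> x = Some y" "\<alpha> y = Some z" "\<alpha> y' = Some z" "\<beta> x' = Some y'"
      "\<gamma> x' = Some w"
      unfolding pcomp_eq_Some_iff pinverse_eq_Some_iff[OF \<alpha>] pinverse_eq_Some_iff[OF \<beta>] by blast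
    have "y = y'" using cofinite_monotone_injections_inject[OF \<alpha> *(2,3)] .
    then have "x = x'" using cofinite_monotone_injections_inject[OF \<beta>, of x y x'] * by simp
    then show "\<gamma> x = Some w" using * by simp
  next
    assume "\<gamma> x = Some w"
    then show "(\<beta> \<Zsemi> \<alpha> \<Zsemi> ?\<delta>) x = Some w"
      using dom_le[of x w]
      unfolding pcomp_eq_Some_iff pinverse_eq_Some_iff[OF \<alpha>] pinverse_eq_Some_iff[OF \<beta>] by blast
  qed
  then have "\<beta> \<Zsemi> \<alpha> \<Zsemi> ?\<delta> = \<gamma>" by (simp add: map_eq_iff_Some)
  moreover have "?\<delta> \<in> cofinite_monotone_injections"
    using \<alpha> \<beta> \<gamma> by (simp add: pcomp_closed pinverse_closed)
  ultimately show thesis using \<beta> that by blast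
qed

text \<open>
  The value \<open>y\<close> at \<open>x\<close> is characterised by having as many elements of the range below it as \<open>x\<close>
  has elements of the domain below it.
\<close>

lemma cofinite_monotone_injections_eqI:
  assumes \<alpha>: "\<alpha> \<in> cofinite_monotone_injections" and \<beta>: "\<beta> \<in> cofinite_monotone_injections"
    and dom: "dom \<alpha> = dom \<beta>" and ran: "ran \<alpha> = ran \<beta>"
  shows "\<alpha> = \<beta>"
proof
  have card: "card {z \<in> ran \<xi>. z < y} = card {t \<in> dom \<xi>. t < x}"
    if \<xi>: "\<xi> \<in> cofinite_monotone_injections" and xy: "\<xi> x = Some y" for \<xi> x y
  proof -
    have "{z \<in> ran \<xi>. z < y} = (\<lambda>t. the (\<xi> t)) ` {t \<in> dom \<xi>. t < x}"
      using cofinite_monotone_injections_less_iff[OF \<xi> _ xy]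
      by (force simp: ran_def dom_def image_iff)
    moreover have "inj_on (\<lambda>t. the (\<xi> t)) {t \<in> dom \<xi>. t < x}"
      using cofinite_monotone_injections_inject[OF \<xi>] by (auto intro!: inj_onI)
    ultimately show ?thesis by (simp add: card_image)
  qed
  fix x
  show "\<alpha> x = \<beta> x"
  proof (cases "\<alpha> x")
    case None
    then show ?thesis using dom by (metis domIff)
  next
    case (Some y)
    then obtain y' where y': "\<beta> x = Some y'" using dom by blast
    have eq: "card {z \<in> ran \<beta>. z < y} = card {z \<in> ran \<beta>. z < y'}"
      using card[OF \<alpha> Some] card[OF \<beta> y'] dom ran by simp
    have less: "card {z \<in> ran \<beta>. z < a} < card {z \<in> ran \<beta>. z < b}" if "a < b" "a \<in> ran \<beta>" for a b
      using that by (intro psubset_card_mono) auto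
    have "y \<in> ran \<beta>" "y' \<in> ran \<beta>"
      using Some y' ran by (auto simp: ran_def)
    then have "y = y'"
      using eq less[of y y'] less[of y' y] by (cases y y' rule: linorder_cases) auto
    then show ?thesis using Some y' by simp
  qed
qed

text \<open>
  There are countably many cofinite sets, and a map is determined by its domain and range.
\<close>

lemma countable_cofinite_monotone_injections: "countable cofinite_monotone_injections"
proof (rule countable_image_inj_on)
  let ?f = "\<lambda>\<alpha> :: nat \<rightharpoonup> nat. ({1..} - dom \<alpha>, {1..} - ran \<alpha>)"
  have "?f ` cofinite_monotone_injections \<subseteq> Collect finite \<times> Collect finite"
    by (auto simp: cofinite_monotone_injections_def)
  then show "countable (?f ` cofinite_monotone_injections)"
    by (rule countable_subset) (intro countable_SIGMA countable_Collect_finite)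
  show "inj_on ?f cofinite_monotone_injections"
  proof (rule inj_onI)
    fix \<alpha> \<beta> assume *: "\<alpha> \<in> cofinite_monotone_injections" "\<beta> \<in> cofinite_monotone_injections"
      "?f \<alpha> = ?f \<beta>"
    then have "dom \<alpha> \<subseteq> {1..}" "dom \<beta> \<subseteq> {1..}" "ran \<alpha> \<subseteq> {1..}" "ran \<beta> \<subseteq> {1..}"
      by (auto simp: cofinite_monotone_injections_def)
    then have "dom \<alpha> = dom \<beta>" "ran \<alpha> = ran \<beta>"
      using *(3) by (metis double_diff prod.inject subset_refl)+
    then show "\<alpha> = \<beta>" using * cofinite_monotone_injections_eqI by blast
  qed
qed

section \<open>Dense subsets and isolated points\<close>

text \<open>
  If no point were isolated, the singletons would be countably many closed sets with empty interior
  that cover the space, against the Baire category theorem.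
\<close>

lemma countable_locally_compact_Hausdorff_isolated_point:
  assumes "locally_compact_space X" "Hausdorff_space X" "countable (topspace X)" "topspace X \<noteq> {}"
  obtains x where "x \<in> topspace X" "openin X {x}"
proof -
  have "\<exists>x\<in>topspace X. X interior_of {x} \<noteq> {}"
  proof (rule ccontr)
    assume *: "\<not> ?thesis"
    have "X interior_of \<Union>((\<lambda>x. {x}) ` topspace X) = {}"
    proof (rule Baire_category_alt)
      show "completely_metrizable_space X \<or> locally_compact_space X \<and> regular_space X"
        using assms locally_compact_Hausdorff_or_regular by blast
      show "countable ((\<lambda>x. {x}) ` topspace X)"
        using assms(3) by simp
      show "closedin X T \<and> X interior_of T = {}" if "T \<in> (\<lambda>x. {x}) ` topspace X" for T
        using that * assms(2) by (auto simp: closedin_Hausdorff_singleton)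
    qed
    then show False using assms(4) by simp
  qed
  then obtain x where "x \<in> topspace X" "X interior_of {x} = {x}"
    by (metis interior_of_subset subset_singletonD)
  then show thesis using that by (metis openin_interior_of)
qed

lemma Hausdorff_space_top_of_set: "Hausdorff_space (top_of_set (D :: 'a::t2_space set))"
proof (rule Hausdorff_space_subtopology)
  show "Hausdorff_space (euclidean :: 'a topology)"
    using hausdorff by (fastforce simp: Hausdorff_space_def disjnt_def)
qed

text \<open>
  By density, \<open>V\<close> lies in the closure of \<open>V \<inter> D\<close>, and a finite set is its own closure.
\<close>

lemma open_subset_dense_if_finite_Int:
  fixes V D :: "'a::t1_space set"
  assumes "open V" "closure D = UNIV" "finite (V \<inter> D)"
  shows "V \<subseteq> D"
proof -
  have "V \<subseteq> closure (V \<inter> D)"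
    using open_Int_closure_subset[OF assms(1), of D] assms(2) by simp
  also have "\<dots> = V \<inter> D"
    using assms(3) by (simp add: finite_imp_closed)
  finally show ?thesis by blast
qed

lemma open_singleton_if_open_finite:
  fixes V :: "'a::t1_space set"
  assumes "open V" "finite V" "x \<in> V"
  shows "open {x}"
proof -
  have "open (V - (V - {x}))"
    using assms by (intro open_Diff finite_imp_closed) auto
  moreover have "V - (V - {x}) = {x}" using assms(3) by blast
  ultimately show ?thesis by simp
qed

section \<open>Products with values at isolated points\<close>

lemma open_mult_nhds:
  fixes s x :: "'a::topological_semigroup_mult"
  assumes "open W" "s * x \<in> W"
  obtains U V where "open U" "s \<in> U" "open V" "x \<in> V" "\<And>u v. u \<in> U \<Longrightarrow> v \<in> V \<Longrightarrow> u * v \<in> W"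
proof -
  have "\<forall>\<^sub>F p in nhds s \<times>\<^sub>F nhds x. fst p * snd p \<in> W"
    using tendsto_mult_Pair[of s x] assms by (rule topological_tendstoD)
  then obtain P Q where "eventually P (nhds s)" "eventually Q (nhds x)"
    and PQ: "\<And>u v. P u \<Longrightarrow> Q v \<Longrightarrow> u * v \<in> W"
    by (auto simp: eventually_prod_filter)
  then show thesis
    using that by (metis eventually_nhds)
qed

text \<open>
  Joint continuity turns \<open>s x = c\<close> into \<open>u v = c\<close> for all \<open>u\<close> near \<open>s\<close> and \<open>v\<close> near \<open>x\<close>. Density
  allows \<open>u\<close> to be chosen in \<open>D\<close>, so that a neighbourhood of \<open>x\<close> has only finitely many points
  of \<open>D\<close>; by density again it lies in \<open>D\<close>.
\<close>

lemma right_factor_in_dense: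
  fixes D :: "'a::{t1_space, topological_semigroup_mult} set"
  assumes dense: "closure D = UNIV" and "open {c}"
    and fin: "\<And>a. a \<in> D \<Longrightarrow> finite {v \<in> D. a * v = c}"
    and "s * x = c"
  shows "x \<in> D"
proof -
  obtain U V where UV: "open U" "s \<in> U" "open V" "x \<in> V"
    and mult: "\<And>u v. u \<in> U \<Longrightarrow> v \<in> V \<Longrightarrow> u * v \<in> {c}"
    using open_mult_nhds[OF \<open>open {c}\<close>, of s x] \<open>s * x = c\<close> by blast
  obtain a where "a \<in> D" "a \<in> U"
    using UV dense by (metis UNIV_I closure_iff_nhds_not_empty disjoint_iff subset_refl)
  then have "V \<inter> D \<subseteq> {v \<in> D. a * v = c}" using mult by blast
  then have "finite (V \<inter> D)" using fin[OF \<open>a \<in> D\<close>] finite_subset by blast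
  then show ?thesis using open_subset_dense_if_finite_Int[OF UV(3) dense] UV(4) by blast
qed

lemma left_factor_in_dense:
  fixes D :: "'a::{t1_space, topological_semigroup_mult} set"
  assumes dense: "closure D = UNIV" and "open {c}"
    and fin: "\<And>a. a \<in> D \<Longrightarrow> finite {u \<in> D. u * a = c}"
    and "x * s = c"
  shows "x \<in> D"
proof -
  obtain U V where UV: "open U" "x \<in> U" "open V" "s \<in> V"
    and mult: "\<And>u v. u \<in> U \<Longrightarrow> v \<in> V \<Longrightarrow> u * v \<in> {c}"
    using open_mult_nhds[OF \<open>open {c}\<close>, of x s] \<open>x * s = c\<close> by blast
  obtain a where "a \<in> D" "a \<in> V"
    using UV dense by (metis UNIV_I closure_iff_nhds_not_empty disjoint_iff subset_refl)
  then have "U \<inter> D \<subseteq> {u \<in> D. u * a = c}" using mult by blast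
  then have "finite (U \<inter> D)" using fin[OF \<open>a \<in> D\<close>] finite_subset by blast
  then show ?thesis using open_subset_dense_if_finite_Int[OF UV(1) dense] UV(2) by blast
qed

lemma open_vimage_mult_both:
  fixes b d :: "'a::topological_semigroup_mult"
  assumes "open W"
  shows "open ((\<lambda>x. b * x * d) -` W)"
proof (rule open_vimage[OF assms])
  show "continuous_on UNIV (\<lambda>x. b * x * d)"
    unfolding continuous_on_def by (intro ballI tendsto_mult tendsto_const tendsto_ident_at)
qed

section \<open>The remainder of a locally compact dense copy\<close>

theorem corollary3p5:
  fixes h :: "(nat \<rightharpoonup> nat) \<Rightarrow> 'a::{t2_space, topological_semigroup_mult}"
  assumes "semigroup_embedding h"
    and "h ` cofinite_monotone_injections \<noteq> UNIV"
    and "closure (h ` cofinite_monotone_injections) = UNIV"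
    and "locally_compact_space (top_of_set (h ` cofinite_monotone_injections))"
  shows "open (h ` cofinite_monotone_injections) \<and>
         subsemigroup (h ` cofinite_monotone_injections) \<and>
         two_sided_ideal (UNIV - h ` cofinite_monotone_injections)"
proof -
  let ?D = "h ` cofinite_monotone_injections"
  have inj: "inj_on h cofinite_monotone_injections"
    and hom: "\<And>\<alpha> \<beta>. \<alpha> \<in> cofinite_monotone_injections \<Longrightarrow> \<beta> \<in> cofinite_monotone_injections \<Longrightarrow>
      h \<alpha> * h \<beta> = h (\<alpha> \<Zsemi> \<beta>)"
    using assms(1) by (simp_all add: semigroup_embedding_def)
  have h_eq_iff: "h \<alpha> = h \<beta> \<longleftrightarrow> \<alpha> = \<beta>"
    if "\<alpha> \<in> cofinite_monotone_injections" "\<beta> \<in> cofinite_monotone_injections" for \<alpha> \<beta>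
    using inj_on_eq_iff[OF inj that] .
  have ne: "?D \<noteq> {}"
    using assms(3) by force
  obtain c where "c \<in> ?D" and c: "openin (top_of_set ?D) {c}"
    using countable_locally_compact_Hausdorff_isolated_point[OF assms(4)] ne
      countable_cofinite_monotone_injections Hausdorff_space_top_of_set
    by (metis countable_image topspace_euclidean_subtopology)
  then obtain \<gamma> where \<gamma>: "\<gamma> \<in> cofinite_monotone_injections" "c = h \<gamma>" by blast
  obtain W where W: "open W" "?D \<inter> W = {h \<gamma>}"
    using c \<gamma>(2) by (auto simp: openin_open)
  have open_singleton: "open {h \<alpha>}" if \<alpha>: "\<alpha> \<in> cofinite_monotone_injections" for \<alpha>
  proof -
    obtain \<beta> \<delta> where \<beta>\<delta>: "\<beta> \<in> cofinite_monotone_injections" "\<delta> \<in> cofinite_monotone_injections"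
      and eq: "\<beta> \<Zsemi> \<alpha> \<Zsemi> \<delta> = \<gamma>"
      using exists_factorization_through[OF \<alpha> \<gamma>(1)] .
    have mult: "h \<beta> * h \<xi> * h \<delta> = h (\<beta> \<Zsemi> \<xi> \<Zsemi> \<delta>)" if "\<xi> \<in> cofinite_monotone_injections" for \<xi>
      using that \<beta>\<delta> by (simp add: hom pcomp_closed)
    let ?V = "(\<lambda>x. h \<beta> * x * h \<delta>) -` W"
    have V: "open ?V" by (rule open_vimage_mult_both[OF W(1)])
    have "?V \<inter> ?D \<subseteq> h ` {\<xi> \<in> cofinite_monotone_injections. \<beta> \<Zsemi> \<xi> \<Zsemi> \<delta> = \<gamma>}"
    proof clarify
      fix \<xi> assume \<xi>: "\<xi> \<in> cofinite_monotone_injections" "h \<beta> * h \<xi> * h \<delta> \<in> W"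
      have closed: "\<beta> \<Zsemi> \<xi> \<Zsemi> \<delta> \<in> cofinite_monotone_injections"
        using \<xi>(1) \<beta>\<delta> by (simp add: pcomp_closed)
      then have "h (\<beta> \<Zsemi> \<xi> \<Zsemi> \<delta>) \<in> ?D \<inter> W" using \<xi> mult by auto
      then have "h (\<beta> \<Zsemi> \<xi> \<Zsemi> \<delta>) = h \<gamma>" using W(2) by blast
      then show "h \<xi> \<in> h ` {\<xi> \<in> cofinite_monotone_injections. \<beta> \<Zsemi> \<xi> \<Zsemi> \<delta> = \<gamma>}"
        using h_eq_iff closed \<gamma>(1) \<xi>(1) by blast
    qed
    then have fin: "finite (?V \<inter> ?D)"
      using finite_solutions_mult_both[OF \<beta>\<delta> \<gamma>(1)] by (meson finite_imageI finite_subset)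
    then have "finite ?V"
      using open_subset_dense_if_finite_Int[OF V assms(3)] by (simp add: Int_absorb2)
    moreover have "h \<alpha> \<in> ?V" using W(2) mult[OF \<alpha>] eq by auto
    ultimately show ?thesis using V open_singleton_if_open_finite by blast
  qed
  have "open (\<Union>x\<in>?D. {x})"
    using open_singleton by blast
  then have "open ?D" by simp
  moreover have "subsemigroup ?D"
    using ne by (auto simp: subsemigroup_def hom pcomp_closed)
  moreover have "x \<in> ?D" if "s * x \<in> ?D \<or> x * s \<in> ?D" for s x
  proof -
    have left: "finite {v \<in> ?D. a * v = h \<gamma>}" and right: "finite {v \<in> ?D. v * a = h \<gamma>}"
      if a: "a \<in> ?D" and \<gamma>: "\<gamma> \<in> cofinite_monotone_injections" for a \<gamma>
    proof -
      obtain \<alpha> where \<alpha>: "\<alpha> \<in> cofinite_monotone_injections" "a = h \<alpha>" using a by blast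
      have "{v \<in> ?D. a * v = h \<gamma>} = h ` {\<xi> \<in> cofinite_monotone_injections. \<alpha> \<Zsemi> \<xi> = \<gamma>}"
        "{v \<in> ?D. v * a = h \<gamma>} = h ` {\<xi> \<in> cofinite_monotone_injections. \<xi> \<Zsemi> \<alpha> = \<gamma>}"
        using \<alpha> \<gamma> by (auto simp: hom h_eq_iff pcomp_closed)
      then show "finite {v \<in> ?D. a * v = h \<gamma>}" "finite {v \<in> ?D. v * a = h \<gamma>}"
        using finite_solutions_mult_left[OF \<alpha>(1) \<gamma>] finite_solutions_mult_right[OF \<alpha>(1) \<gamma>]
        by simp_all
    qed
    show ?thesis
      using that
    proof
      assume "s * x \<in> ?D"
      then obtain \<gamma> where "\<gamma> \<in> cofinite_monotone_injections" "s * x = h \<gamma>" by blast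
      then show ?thesis
        using right_factor_in_dense[OF assms(3) open_singleton left] by blast
    next
      assume "x * s \<in> ?D"
      then obtain \<gamma> where "\<gamma> \<in> cofinite_monotone_injections" "x * s = h \<gamma>" by blast
      then show ?thesis
        using left_factor_in_dense[OF assms(3) open_singleton right] by blast
    qed
  qed
  then have "two_sided_ideal (UNIV - ?D)"
    using assms(2) unfolding two_sided_ideal_def by blast
  ultimately show ?thesis by blast
qed

end
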